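(* Let $\mathcal{H}_R$ and $\mathcal{H}_S$ be finite-dimensional complex Hilbert spaces and let $\mathcal{J}:\mathcal{H}_R\to\mathcal{H}_R\otimes\mathcal{H}_S$ be an isometry. The following statements are equivalent: (i) $\mathcal{J}$ generates a unitary from $\mathcal{H}_R$ to itself, in the sense that there are a unitary operator $\mathcal{U}:\mathcal{H}_R\to\mathcal{H}_R$ and a fixed normalized state $|s_0\rangle\in\mathcal{H}_S$ (independent of $|r\rangle$) such that $\mathcal{J}|r\rangle=(\mathcal{U}|r\rangle)\otimes|s_0\rangle$ for all $|r\rangle\in\mathcal{H}_R$. (ii) There is no information about the initial state of $R$ available in $S$ after applying $\mathcal{J}$. (iii) For some orthonormal basis $\{|s_j\rangle\}$ of $\mathcal{H}_S$, the Kraus operators $K_j:\mathcal{H}_R\to\mathcal{H}_R$ determined by $\mathcal{J}|r\rangle=\sum_j K_j|r\rangle\otimes|s_j\rangle$ (for all $|r\rangle\in\mathcal{H}_R$) are of the form $K_j=c_j\mathcal{W}$, with the $c_j$ complex numbers and $\mathcal{W}$ a linear map from $\mathcal{H}_R$ to itself (independent of $j$).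
   Context: "No information about the initial state of $R$ is available in $S$" means that the final state of $S$ is uncorrelated with the initial state of $R$, so that no measurement on $S$ yields any information about it: the reduced density operator $\mathrm{Tr}_R\big(\mathcal{J}|r\rangle\langle r|\mathcal{J}^\dagger\big)$ on $\mathcal{H}_S$ is the same for all normalized $|r\rangle\in\mathcal{H}_R$. Equivalently, for every orthonormal basis of $\mathcal{H}_S$, the outcome probabilities of measuring $S$ in that basis do not depend on the normalized input $|r\rangle$. *)

theory Defs
  imports "HOL-Analysis.Analysis"
begin

text \<open>
  Finite-dimensional complex Hilbert spaces are the coordinate spaces \<open>complex ^ 'n\<close> (of arbitrary
  dimension \<open>CARD('n) \<ge> 1\<close>); their library norm is the Hilbert space norm.  The tensor product of
  \<open>complex ^ 'r\<close> and \<open>complex ^ 's\<close> is \<open>complex ^ ('r \<times> 's)\<close>, and linear maps are matrices.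
\<close>

text \<open>As in the bra-ket convention, conjugate-linear in the first argument.\<close>
definition cinner :: "complex ^ 'n \<Rightarrow> complex ^ 'n \<Rightarrow> complex" where
  "cinner x y = (\<Sum>i\<in>UNIV. cnj (x $ i) * y $ i)"

definition cadjoint :: "complex ^ 'n ^ 'm \<Rightarrow> complex ^ 'm ^ 'n" where
  "cadjoint A = (\<chi> i j. cnj (A $ j $ i))"

definition isometry :: "complex ^ 'n ^ 'm \<Rightarrow> bool" where
  "isometry A \<longleftrightarrow> cadjoint A ** A = mat 1"

definition unitary :: "complex ^ 'n ^ 'n \<Rightarrow> bool" where
  "unitary U \<longleftrightarrow> cadjoint U ** U = mat 1 \<and> U ** cadjoint U = mat 1"

text \<open>Every orthonormal basis of \<open>complex ^ 'n\<close> has \<open>CARD('n)\<close> elements, so it can be indexed by \<open>'n\<close>.\<close>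
definition orthonormal_basis :: "('n \<Rightarrow> complex ^ 'n) \<Rightarrow> bool" where
  "orthonormal_basis s \<longleftrightarrow>
     (\<forall>i j. cinner (s i) (s j) = (if i = j then 1 else 0)) \<and> vec.span (range s) = UNIV"

definition tensor :: "complex ^ 'r \<Rightarrow> complex ^ 's \<Rightarrow> complex ^ ('r::finite \<times> 's::finite)" (infixr "\<otimes>\<^sub>v" 75) where
  "x \<otimes>\<^sub>v y = (\<chi> p. x $ fst p * y $ snd p)"

text \<open>The operator \<open>|x\<rangle>\<langle>y|\<close>.\<close>
definition ketbra :: "complex ^ 'n \<Rightarrow> complex ^ 'm \<Rightarrow> complex ^ 'm ^ 'n" where
  "ketbra x y = (\<chi> i j. x $ i * cnj (y $ j))"

definition partial_trace_fst ::
    "complex ^ ('r::finite \<times> 's::finite) ^ ('r::finite \<times> 's::finite) \<Rightarrow> complex ^ 's ^ 's" where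
  "partial_trace_fst A = (\<chi> i j. \<Sum>a\<in>UNIV. A $ (a, i) $ (a, j))"

definition reduced_state :: "complex ^ 'r ^ ('r::finite \<times> 's::finite) \<Rightarrow> complex ^ 'r \<Rightarrow> complex ^ 's ^ 's" where
  "reduced_state J r = partial_trace_fst (J ** ketbra r r ** cadjoint J)"

definition no_information_in_snd :: "complex ^ 'r ^ ('r::finite \<times> 's::finite) \<Rightarrow> bool" where
  "no_information_in_snd J \<longleftrightarrow>
     (\<forall>r r'. norm r = 1 \<longrightarrow> norm r' = 1 \<longrightarrow> reduced_state J r = reduced_state J r')"

definition generates_unitary :: "complex ^ 'r ^ ('r::finite \<times> 's::finite) \<Rightarrow> bool" where
  "generates_unitary J \<longleftrightarrow>
     (\<exists>U s0. unitary U \<and> norm s0 = 1 \<and> (\<forall>r. J *v r = (U *v r) \<otimes>\<^sub>v s0))"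

definition kraus_operators ::
    "complex ^ 'r ^ ('r::finite \<times> 's::finite) \<Rightarrow> ('s \<Rightarrow> complex ^ 's) \<Rightarrow> ('s \<Rightarrow> complex ^ 'r ^ 'r) \<Rightarrow> bool" where
  "kraus_operators J s K \<longleftrightarrow> (\<forall>r. J *v r = (\<Sum>j\<in>UNIV. (K j *v r) \<otimes>\<^sub>v s j))"

lemma cinner_self: "cinner x x = complex_of_real ((norm x)\<^sup>2)"
proof -
  have "(norm x)\<^sup>2 = (\<Sum>i\<in>UNIV. (norm (x $ i))\<^sup>2)"
    by (simp add: norm_vec_def L2_set_def sum_nonneg)
  then show ?thesis
    by (simp add: cinner_def complex_norm_square mult.commute del: of_real_power)
qed

lemma cinner_cadjoint: "cinner (A *v x) y = cinner x (cadjoint A *v y)"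
proof -
  have "cinner (A *v x) y = (\<Sum>i\<in>UNIV. \<Sum>j\<in>UNIV. cnj (A $ i $ j) * cnj (x $ j) * y $ i)"
    by (simp add: cinner_def matrix_vector_mult_def sum_distrib_right)
  also have "\<dots> = (\<Sum>j\<in>UNIV. \<Sum>i\<in>UNIV. cnj (A $ i $ j) * cnj (x $ j) * y $ i)"
    by (rule sum.swap)
  also have "\<dots> = cinner x (cadjoint A *v y)"
    by (simp add: cinner_def cadjoint_def matrix_vector_mult_def sum_distrib_left mult_ac)
  finally show ?thesis .
qed

lemma cinner_tensor: "cinner (x \<otimes>\<^sub>v y) (x' \<otimes>\<^sub>v y') = cinner x x' * cinner y y'"
proof -
  have "cinner (x \<otimes>\<^sub>v y) (x' \<otimes>\<^sub>v y')
      = (\<Sum>(a, b)\<in>UNIV \<times> UNIV. (cnj (x $ a) * x' $ a) * (cnj (y $ b) * y' $ b))"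
    by (simp add: cinner_def tensor_def case_prod_beta mult_ac)
  also have "\<dots> = cinner x x' * cinner y y'"
    by (simp add: cinner_def sum.cartesian_product sum_product flip: UNIV_Times_UNIV)
  finally show ?thesis .
qed

text \<open>
  The operator \<open>(1 \<otimes> \<langle>t|) J\<close>; used only to show that the Kraus operators with respect to an orthonormal
  basis exist and are unique.
\<close>
definition kraus_component ::
    "complex ^ 'r ^ ('r::finite \<times> 's::finite) \<Rightarrow> complex ^ 's \<Rightarrow> complex ^ 'r ^ 'r" where
  "kraus_component J t = (\<chi> a b. \<Sum>i\<in>UNIV. cnj (t $ i) * J $ (a, i) $ b)"

lemma kraus_operators_unique:
  assumes s: "orthonormal_basis s" and K: "kraus_operators J s K"
  shows "K j = kraus_component J (s j)"
proof -
  have on: "cinner (s i) (s k) = (if i = k then 1 else 0)" for i k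
    using s by (simp add: orthonormal_basis_def)
  have "K j *v r = kraus_component J (s j) *v r" for r
  proof (rule vec_eq_iff[THEN iffD2], rule allI)
    fix a
    have "(kraus_component J (s j) *v r) $ a
        = (\<Sum>b\<in>UNIV. \<Sum>i\<in>UNIV. cnj (s j $ i) * J $ (a, i) $ b * r $ b)"
      by (simp add: kraus_component_def matrix_vector_mult_def sum_distrib_right)
    also have "\<dots> = (\<Sum>i\<in>UNIV. \<Sum>b\<in>UNIV. cnj (s j $ i) * J $ (a, i) $ b * r $ b)"
      by (rule sum.swap)
    also have "\<dots> = (\<Sum>i\<in>UNIV. cnj (s j $ i) * (J *v r) $ (a, i))"
      by (simp add: matrix_vector_mult_def sum_distrib_left mult_ac)
    also have "\<dots> = (\<Sum>i\<in>UNIV. \<Sum>k\<in>UNIV. cnj (s j $ i) * ((K k *v r) $ a * s k $ i))"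
      using K by (simp add: kraus_operators_def tensor_def sum_component sum_distrib_left)
    also have "\<dots> = (\<Sum>k\<in>UNIV. \<Sum>i\<in>UNIV. cnj (s j $ i) * ((K k *v r) $ a * s k $ i))"
      by (rule sum.swap)
    also have "\<dots> = (\<Sum>k\<in>UNIV. (K k *v r) $ a * cinner (s j) (s k))"
      by (simp add: cinner_def sum_distrib_left mult_ac)
    also have "\<dots> = (K j *v r) $ a"
      by (simp add: on if_distrib cong: if_cong)
    finally show "(K j *v r) $ a = (kraus_component J (s j) *v r) $ a"
      by simp
  qed
  then show ?thesis
    by (simp add: matrix_eq)
qed

lemma kraus_operators_exist:
  fixes J :: "complex ^ 'r ^ ('r::finite \<times> 's::finite)"
  assumes s: "orthonormal_basis s"
  shows "kraus_operators J s (\<lambda>j. kraus_component J (s j))"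
proof -
  define S :: "complex ^ 's ^ 's" where "S = (\<chi> i j. s j $ i)"
  have "cadjoint S ** S = mat 1"
    using s by (simp add: orthonormal_basis_def S_def cadjoint_def matrix_matrix_mult_def mat_def
        cinner_def vec_eq_iff)
  then have "S ** cadjoint S = mat 1"
    by (simp add: matrix_left_right_inverse)
  then have res: "(\<Sum>j\<in>UNIV. s j $ i * cnj (s j $ k)) = (if i = k then 1 else 0)" for i k
    by (simp add: S_def cadjoint_def matrix_matrix_mult_def mat_def vec_eq_iff)
  show ?thesis
    unfolding kraus_operators_def
  proof (intro allI vec_eq_iff[THEN iffD2])
    fix r :: "complex ^ 'r" and p :: "'r \<times> 's"
    obtain a i where p: "p = (a, i)" by (cases p)
    have K: "(kraus_component J (s j) *v r) $ a
        = (\<Sum>k\<in>UNIV. cnj (s j $ k) * (J *v r) $ (a, k))" for j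
    proof -
      have "(kraus_component J (s j) *v r) $ a
        = (\<Sum>b\<in>UNIV. \<Sum>i\<in>UNIV. cnj (s j $ i) * J $ (a, i) $ b * r $ b)"
        by (simp add: kraus_component_def matrix_vector_mult_def sum_distrib_right)
      also have "\<dots> = (\<Sum>i\<in>UNIV. \<Sum>b\<in>UNIV. cnj (s j $ i) * J $ (a, i) $ b * r $ b)"
        by (rule sum.swap)
      finally show ?thesis
        by (simp add: matrix_vector_mult_def sum_distrib_left mult_ac)
    qed
    have "(\<Sum>j\<in>UNIV. (kraus_component J (s j) *v r) \<otimes>\<^sub>v s j) $ p
        = (\<Sum>j\<in>UNIV. \<Sum>k\<in>UNIV. cnj (s j $ k) * (J *v r) $ (a, k) * s j $ i)"
      by (simp add: p tensor_def sum_component K sum_distrib_right)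
    also have "\<dots> = (\<Sum>k\<in>UNIV. \<Sum>j\<in>UNIV. cnj (s j $ k) * (J *v r) $ (a, k) * s j $ i)"
      by (rule sum.swap)
    also have "\<dots> = (\<Sum>k\<in>UNIV. (J *v r) $ (a, k) * (\<Sum>j\<in>UNIV. s j $ i * cnj (s j $ k)))"
      by (simp add: sum_distrib_left mult_ac)
    also have "\<dots> = (J *v r) $ p"
      by (simp add: res p if_distrib cong: if_cong)
    finally show "(J *v r) $ p =
      (\<Sum>j\<in>UNIV. (kraus_component J (s j) *v r) \<otimes>\<^sub>v s j) $ p"
      by simp
  qed
qed

lemma ex1_kraus_operators:
  assumes "orthonormal_basis s"
  shows "\<exists>!K. kraus_operators J s K"
  using assms kraus_operators_exist kraus_operators_unique by (metis (no_types, lifting) ext)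

end

theory Submission
  imports Defs
begin

text \<open>
  Let \<open>K\<^sub>i\<close> be the Kraus operators for the coordinate basis.  The \<open>(i, j)\<close> entry of the reduced state
  is \<open>\<langle>K\<^sub>j r, K\<^sub>i r\<rangle>\<close>, so if no information is available, polarization gives
  \<open>K\<^sub>j\<^sup>\<dagger> K\<^sub>i = \<rho>\<^sub>i\<^sub>j 1\<close>.  Some \<open>K\<^sub>l\<close> is nonzero, and then it is a multiple of a unitary because it
  is square, so every \<open>K\<^sub>i\<close> is a multiple of \<open>K\<^sub>l\<close>.  Conversely, if \<open>K\<^sub>j = c\<^sub>j W\<close> then
  \<open>J r = W r \<otimes> s\<close> with \<open>s = \<Sum>\<^sub>j c\<^sub>j s\<^sub>j\<close>, and the isometry property makes \<open>\<parallel>s\<parallel> W\<close> unitary.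
\<close>

lemma cinner_add_left: "cinner (x + y) z = cinner x z + cinner y z"
  by (simp add: cinner_def algebra_simps sum.distrib)

lemma cinner_add_right: "cinner x (y + z) = cinner x y + cinner x z"
  by (simp add: cinner_def algebra_simps sum.distrib)

lemma cinner_diff_right: "cinner x (y - z) = cinner x y - cinner x z"
  by (simp add: cinner_def algebra_simps sum_subtractf)

lemma cinner_scale_left: "cinner (c *s x) y = cnj c * cinner x y"
  by (simp add: cinner_def algebra_simps sum_distrib_left)

lemma cinner_scale_right: "cinner x (c *s y) = c * cinner x y"
  by (simp add: cinner_def algebra_simps sum_distrib_left)

lemma cinner_axis_left: "cinner (axis i 1) x = x $ i"
proof -
  have "cinner (axis i 1) x = (\<Sum>k\<in>UNIV. if k = i then x $ k else 0)"
    unfolding cinner_def by (rule sum.cong) (auto simp: axis_def)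
  then show ?thesis by simp
qed

lemma norm_vector_scale: "norm (c *s x) = norm c * norm (x :: complex ^ 'n)"
  by (simp add: norm_vec_def L2_set_def norm_mult power_mult_distrib sum_distrib_left[symmetric]
      real_sqrt_mult)

lemma matrix_eq_cinnerI:
  fixes A B :: "complex ^ 'n ^ 'm"
  assumes "\<And>x y. cinner x (A *v y) = cinner x (B *v y)"
  shows "A = B"
  unfolding matrix_eq by (metis assms cinner_axis_left vec_eq_iff)

text \<open>Complex polarization: the quadratic form of \<open>A - c\<close> vanishes on unit
  vectors, hence everywhere by scaling, and over the complex numbers this forces the operator itself
  to vanish.\<close>

lemma matrix_eq_mat_if_cinner_const:
  fixes A :: "complex ^ 'n ^ 'n"
  assumes const: "\<And>r. norm r = 1 \<Longrightarrow> cinner r (A *v r) = c"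
  shows "A = mat c"
proof (rule matrix_eq_cinnerI)
  fix x y :: "complex ^ 'n"
  have matc: "mat c *v v = c *s v" for v :: "complex ^ 'n"
    by (simp add: vec_eq_iff matrix_vector_mult_def mat_def if_distrib if_distribR cong: if_cong)
  define f where "f v = A *v v - c *s v" for v
  have f_add: "f (u + v) = f u + f v" for u v
    by (simp add: f_def matrix_vector_right_distrib vec.scale_right_distrib)
  have f_scale: "f (a *s v) = a *s f v" for a v
    by (simp add: f_def vec.scale vec.scale_right_diff_distrib mult.commute)
  have Q: "cinner r (f r) = 0" for r
  proof (cases "r = 0")
    case True
    then show ?thesis by (simp add: cinner_def)
  next
    case False
    define u where "u = complex_of_real (inverse (norm r)) *s r"
    have u: "norm u = 1"
      using False by (simp add: u_def norm_vector_scale norm_inverse)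
    have r: "r = complex_of_real (norm r) *s u"
      using False by (simp add: u_def vec_eq_iff)
    have "cinner u (f u) = 0"
      using const[OF u] u by (simp add: f_def cinner_diff_right cinner_scale_right cinner_self)
    then show ?thesis
      by (subst (1 2) r) (simp add: f_scale cinner_scale_left cinner_scale_right)
  qed
  have 1: "cinner x (f y) + cinner y (f x) = 0"
    using Q[of "x + y"] by (simp add: f_add cinner_add_left cinner_add_right Q add.commute)
  \<comment> \<open>The vector \<open>x + y\<close> controls only the sum of the two cross terms.
    The phase \<open>\<i>\<close> turns the sum into a difference, so both terms vanish.\<close>
  have "\<i> * (cinner x (f y) - cinner y (f x)) = 0"
    using Q[of "x + \<i> *s y"]
    by (simp add: f_add f_scale cinner_add_left cinner_add_right cinner_scale_left
        cinner_scale_right Q right_diff_distrib)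
  with 1 have "cinner x (f y) = 0"
    by (simp add: add_eq_0_iff)
  then show "cinner x (A *v y) = cinner x (mat c *v y)"
    by (simp add: f_def cinner_diff_right matc)
qed

lemma isometry_cinner: "isometry A \<Longrightarrow> cinner (A *v x) (A *v y) = cinner x y"
  by (simp add: isometry_def cinner_cadjoint matrix_vector_mul_assoc)

text \<open>Preserving inner products gives only a left inverse; it is two-sided because
  \<open>U\<close> is square.\<close>

lemma unitaryI_cinner:
  fixes U :: "complex ^ 'n ^ 'n"
  assumes "\<And>x y. cinner (U *v x) (U *v y) = cinner x y"
  shows "unitary U"
proof -
  have "cadjoint U ** U = mat 1"
    by (rule matrix_eq_cinnerI)
      (simp add: assms cinner_cadjoint[symmetric] matrix_vector_mul_assoc[symmetric])
  then show ?thesis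
    by (simp add: unitary_def matrix_left_right_inverse)
qed

lemma isometry_norm:
  assumes "isometry A"
  shows "norm (A *v x) = norm x"
proof -
  have "(norm (A *v x))\<^sup>2 = (norm x)\<^sup>2"
    using isometry_cinner[OF assms, of x x] by (simp add: cinner_self del: of_real_power)
  then show ?thesis by simp
qed

lemma orthonormal_basis_axis: "orthonormal_basis (\<lambda>i. axis i 1 :: complex ^ 'n)"
proof -
  have "range (\<lambda>i. axis i 1 :: complex ^ 'n) = cart_basis"
    by (auto simp: cart_basis_def)
  then show ?thesis
    unfolding orthonormal_basis_def cinner_axis_left
    by (auto simp: vec.span_Basis axis_def)
qed

lemma reduced_state_component:
  "reduced_state J r $ i $ j = (\<Sum>a\<in>UNIV. (J *v r) $ (a, i) * cnj ((J *v r) $ (a, j)))"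
  unfolding reduced_state_def partial_trace_fst_def
  by (simp add: matrix_matrix_mult_def ketbra_def cadjoint_def matrix_vector_mult_def
      sum_distrib_right sum_distrib_left mult_ac)

text \<open>For the coordinate basis the Kraus operators are slices of \<open>J\<close>, which makes
  the reduced state a Gram matrix of the vectors \<open>K i *v r\<close>.\<close>

lemma kraus_component_axis_mult:
  "(kraus_component J (axis i 1) *v r) $ a = (J *v r) $ (a, i)"
proof -
  have "kraus_component J (axis i 1) $ a $ b = J $ (a, i) $ b" for b
    using cinner_axis_left[of i "\<chi> k. J $ (a, k) $ b"] by (simp add: kraus_component_def cinner_def)
  then show ?thesis
    by (simp add: matrix_vector_mult_def)
qed

lemma reduced_state_kraus_component:
  "reduced_state J r $ i $ j =
    cinner (kraus_component J (axis j 1) *v r) (kraus_component J (axis i 1) *v r)"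
  by (simp add: reduced_state_component cinner_def kraus_component_axis_mult mult.commute)

text \<open>The reduced state is \<open>ketbra s0 s0\<close> for every unit input, since the factor
  coming from \<open>U *v r\<close> is its squared norm, which is 1.\<close>

lemma generates_unitary_imp_no_information:
  assumes "generates_unitary J"
  shows "no_information_in_snd J"
proof -
  obtain U s0 where U: "unitary U" and J: "\<And>r. J *v r = (U *v r) \<otimes>\<^sub>v s0"
    using assms by (auto simp: generates_unitary_def)
  have "reduced_state J r $ i $ j = s0 $ i * cnj (s0 $ j)" if "norm r = 1" for r i j
  proof -
    have "isometry U"
      using U by (simp add: unitary_def isometry_def)
    then have "cinner (U *v r) (U *v r) = 1"
      using that by (simp add: cinner_self isometry_norm)
    moreover have "reduced_state J r $ i $ j = cinner (U *v r) (U *v r) * (s0 $ i * cnj (s0 $ j))"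
      by (simp add: reduced_state_component J tensor_def cinner_def sum_distrib_left mult_ac)
    ultimately show ?thesis by simp
  qed
  then show ?thesis
    by (simp add: no_information_in_snd_def vec_eq_iff)
qed

lemma no_information_imp_kraus_proportional:
  fixes J :: "complex ^ 'r ^ ('r::finite \<times> 's::finite)"
  assumes J: "isometry J" and no: "no_information_in_snd J"
  obtains c :: "'s \<Rightarrow> complex" and W :: "complex ^ 'r ^ 'r"
  where "\<And>j v. kraus_component J (axis j 1) *v v = c j *s (W *v v)"
proof -
  define K where "K i = kraus_component J (axis i 1)" for i :: 's
  \<comment> \<open>Any unit vector serves here; it only gives a name \<open>\<rho>\<close> to the
    common reduced state.\<close>
  define e :: "complex ^ 'r" where "e = axis undefined 1"
  define \<rho> where "\<rho> = reduced_state J e"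
  have e: "norm e = 1"
    by (simp add: e_def norm_axis_1)
  have KK: "cadjoint (K j) ** K i = mat (\<rho> $ i $ j)" for i j
  proof (rule matrix_eq_mat_if_cinner_const)
    fix r :: "complex ^ 'r"
    assume "norm r = 1"
    then have "reduced_state J r = \<rho>"
      using no e unfolding no_information_in_snd_def \<rho>_def by blast
    then show "cinner r (cadjoint (K j) ** K i *v r) = \<rho> $ i $ j"
      by (simp add: reduced_state_kraus_component[symmetric] K_def
          matrix_vector_mul_assoc[symmetric] cinner_cadjoint[symmetric])
  qed
  \<comment> \<open>Some slice of \<open>J *v e\<close> is nonzero, and the diagonal entry of
    \<open>\<rho>\<close> at \<open>l\<close> is its squared norm.\<close>
  have "J *v e \<noteq> 0"
    using isometry_norm[OF J, of e] e by auto
  then obtain a l where "(K l *v e) $ a \<noteq> 0"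
    by (auto simp: vec_eq_iff K_def kraus_component_axis_mult)
  then have "K l *v e \<noteq> 0"
    by auto
  then have l: "\<rho> $ l $ l \<noteq> 0"
    by (simp add: \<rho>_def reduced_state_kraus_component K_def cinner_self)
  \<comment> \<open>By \<open>KK\<close>, this rescaled adjoint is a left inverse of
    \<open>K l\<close>, hence also a right inverse, as \<open>K l\<close> is square.\<close>
  define B where "B = (\<chi> i j. inverse (\<rho> $ l $ l) * cadjoint (K l) $ i $ j)"
  have B: "B ** A = (\<chi> i j. inverse (\<rho> $ l $ l) * (cadjoint (K l) ** A) $ i $ j)"
    for A :: "complex ^ 'r ^ 'r"
    by (simp add: B_def matrix_matrix_mult_def sum_distrib_left mult.assoc)
  have "B ** K l = mat 1"
    using l by (simp add: B KK) (simp add: mat_def vec_eq_iff)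
  then have KB: "K l ** B = mat 1"
    by (simp add: matrix_left_right_inverse)
  \<comment> \<open>Insert \<open>K l ** B = mat 1\<close> in front of \<open>K j\<close>; by
    \<open>KK\<close>, \<open>B ** K j\<close> is a scalar. Thus \<open>K l\<close> serves as
    \<open>W\<close>.\<close>
  have "K j *v v = (\<rho> $ j $ l / \<rho> $ l $ l) *s (K l *v v)" for j v
  proof -
    have "B ** K j *v v = (\<rho> $ j $ l / \<rho> $ l $ l) *s v"
      by (simp add: B KK vec_eq_iff matrix_vector_mult_def mat_def if_distrib if_distribR
          field_simps cong: if_cong)
    moreover have "K j *v v = K l *v (B ** K j *v v)"
      by (simp add: matrix_vector_mul_assoc matrix_mul_assoc KB)
    ultimately show ?thesis
      by (simp add: vec.scale)
  qed
  then show thesis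
    unfolding K_def by (rule that)
qed

lemma kraus_proportional_imp_generates_unitary:
  fixes J :: "complex ^ 'r ^ ('r::finite \<times> 's::finite)"
  assumes J: "isometry J" and K: "kraus_operators J s K"
    and W: "\<And>j v. K j *v v = c j *s (W *v v)"
  shows "generates_unitary J"
proof -
  \<comment> \<open>By bilinearity the Kraus sum collapses to a single product with
    \<open>t\<close>.\<close>
  define t where "t = (\<Sum>j\<in>UNIV. c j *s s j)"
  have Jt: "J *v r = (W *v r) \<otimes>\<^sub>v t" for r
  proof -
    have "J *v r = (\<Sum>j\<in>UNIV. (K j *v r) \<otimes>\<^sub>v s j)"
      using K by (simp add: kraus_operators_def)
    then show ?thesis
      by (simp add: W vec_eq_iff tensor_def t_def sum_component sum_distrib_left mult_ac)
  qed
  \<comment> \<open>Moving the factor \<open>n\<close> from \<open>t\<close> to \<open>W\<close>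
    normalizes the state without changing the tensor product, and the isometry property then makes
    the rescaled \<open>W\<close> unitary.\<close>
  define n where "n = complex_of_real (norm t)"
  have "t \<noteq> 0"
  proof
    assume "t = 0"
    then have "J *v axis undefined 1 = 0"
      by (simp add: Jt tensor_def vec_eq_iff)
    then show False
      using isometry_norm[OF J, of "axis undefined 1"] by (simp add: norm_axis_1)
  qed
  then have n: "n \<noteq> 0"
    by (simp add: n_def)
  define U where "U = (\<chi> i j. n * W $ i $ j)"
  have U: "U *v r = n *s (W *v r)" for r
    by (simp add: U_def matrix_vector_mult_def vec_eq_iff sum_distrib_left mult.assoc)
  have "unitary U"
  proof (rule unitaryI_cinner)
    fix x y
    have "cinner (U *v x) (U *v y) = cinner (J *v x) (J *v y)"
      unfolding Jt cinner_tensor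
      by (simp add: U cinner_scale_left cinner_scale_right cinner_self n_def power2_eq_square)
    then show "cinner (U *v x) (U *v y) = cinner x y"
      by (simp add: isometry_cinner J)
  qed
  moreover have "norm (inverse n *s t) = 1"
    using n by (simp add: norm_vector_scale norm_inverse n_def)
  moreover have "J *v r = (U *v r) \<otimes>\<^sub>v (inverse n *s t)" for r
    using n by (simp add: Jt U tensor_def vec_eq_iff)
  ultimately show ?thesis
    unfolding generates_unitary_def by blast
qed

theorem theorem1:
  fixes J :: "complex ^ 'r ^ ('r::finite \<times> 's::finite)"
  assumes "isometry J"
  shows "(generates_unitary J \<longleftrightarrow> no_information_in_snd J) \<and>
    (no_information_in_snd J \<longleftrightarrow>
      (\<exists>s K. orthonormal_basis s \<and> kraus_operators J s K \<and>
        (\<exists>(c :: 's \<Rightarrow> complex) (W :: complex ^ 'r ^ 'r).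
          \<forall>j v. K j *v v = c j *s (W *v v))))"
    (is "_ \<and> (_ \<longleftrightarrow> ?kraus)")
proof -
  \<comment> \<open>The coordinate basis is the witness. The equivalences follow from a cycle of
    three implications.\<close>
  have ?kraus if no: "no_information_in_snd J"
  proof -
    obtain c :: "'s \<Rightarrow> complex" and W
      where "\<And>j v. kraus_component J (axis j 1) *v v = c j *s (W *v v)"
      using no_information_imp_kraus_proportional[OF assms no] by blast
    then show ?thesis
      using orthonormal_basis_axis kraus_operators_exist[OF orthonormal_basis_axis, of J] by blast
  qed
  moreover have "generates_unitary J" if ?kraus
    using that kraus_proportional_imp_generates_unitary[OF assms] by blast
  ultimately show ?thesis
    using generates_unitary_imp_no_information by blast
qed

end
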